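(* If $\mathsf L$ is a locally tabular intermediate logic with finitary or unitary unification and $\mathsf L'$ is an intermediate logic with projective unification, then $\mathsf L\cap\mathsf L'$ has finitary or unitary unification.
   Context: An intermediate logic is a set of intuitionistic propositional formulas containing $\mathsf{INT}$, closed under modus ponens and substitution; it is locally tabular if for each $n$ there are only finitely many formulas in variables $x_1,\dots,x_n$ up to $\mathsf L$-provable equivalence. A substitution $\varepsilon$ is an $\mathsf L$-unifier of $A$ if $\varepsilon(A)\in\mathsf L$; $\varepsilon\preccurlyeq\mu$ iff $\alpha\circ\varepsilon=_{\mathsf L}\mu$ for some $\alpha$. Unification is unitary if every unifiable formula has a unifier $\preccurlyeq$ all its unifiers, finitary if not unitary and every unifiable formula has a finite complete set of unifiers (each unifier is $\succcurlyeq$ some member). An $\mathsf L$-unifier $\varepsilon$ of $A$ is projective if $A\vdash_{\mathsf L}\varepsilon(x)\leftrightarrow x$ for every variable $x$; $\mathsf L'$ has projective unification if every $\mathsf L'$-unifiable formula has a projective $\mathsf L'$-unifier. *)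

theory Defs
  imports Main
begin

datatype fm =
    Var nat
  | Bot (\<open>\<^bold>\<bottom>\<close>)
  | And fm fm (infixr \<open>\<^bold>\<and>\<close> 70)
  | Or fm fm (infixr \<open>\<^bold>\<or>\<close> 65)
  | Imp fm fm (infixr \<open>\<^bold>\<rightarrow>\<close> 60)

definition Iff :: "fm \<Rightarrow> fm \<Rightarrow> fm" (infix \<open>\<^bold>\<leftrightarrow>\<close> 55) where
  "A \<^bold>\<leftrightarrow> B = (A \<^bold>\<rightarrow> B) \<^bold>\<and> (B \<^bold>\<rightarrow> A)"

primrec vars :: "fm \<Rightarrow> nat set" where
  "vars (Var x) = {x}"
| "vars \<^bold>\<bottom> = {}"
| "vars (A \<^bold>\<and> B) = vars A \<union> vars B"
| "vars (A \<^bold>\<or> B) = vars A \<union> vars B"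
| "vars (A \<^bold>\<rightarrow> B) = vars A \<union> vars B"

text \<open>A substitution assigns a formula to every variable. It need not have finite support,
  and substitutions are compared below on all variables. As there are infinitely many
  variables, a unifier can rename those not occurring in the formula away from the variables
  it uses, so comparing only on the variables of the formula yields the same unification
  types.\<close>

type_synonym substitution = "nat \<Rightarrow> fm"

primrec subst :: "substitution \<Rightarrow> fm \<Rightarrow> fm" where
  "subst \<sigma> (Var x) = \<sigma> x"
| "subst \<sigma> \<^bold>\<bottom> = \<^bold>\<bottom>"
| "subst \<sigma> (A \<^bold>\<and> B) = subst \<sigma> A \<^bold>\<and> subst \<sigma> B"
| "subst \<sigma> (A \<^bold>\<or> B) = subst \<sigma> A \<^bold>\<or> subst \<sigma> B"
| "subst \<sigma> (A \<^bold>\<rightarrow> B) = subst \<sigma> A \<^bold>\<rightarrow> subst \<sigma> B"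

inductive_set IPC :: "fm set" where
  K: "A \<^bold>\<rightarrow> B \<^bold>\<rightarrow> A \<in> IPC"
| S: "(A \<^bold>\<rightarrow> B \<^bold>\<rightarrow> C) \<^bold>\<rightarrow> (A \<^bold>\<rightarrow> B) \<^bold>\<rightarrow> A \<^bold>\<rightarrow> C \<in> IPC"
| AndI: "A \<^bold>\<rightarrow> B \<^bold>\<rightarrow> A \<^bold>\<and> B \<in> IPC"
| AndE1: "A \<^bold>\<and> B \<^bold>\<rightarrow> A \<in> IPC"
| AndE2: "A \<^bold>\<and> B \<^bold>\<rightarrow> B \<in> IPC"
| OrI1: "A \<^bold>\<rightarrow> A \<^bold>\<or> B \<in> IPC"
| OrI2: "B \<^bold>\<rightarrow> A \<^bold>\<or> B \<in> IPC"
| OrE: "(A \<^bold>\<rightarrow> C) \<^bold>\<rightarrow> (B \<^bold>\<rightarrow> C) \<^bold>\<rightarrow> A \<^bold>\<or> B \<^bold>\<rightarrow> C \<in> IPC"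
| BotE: "\<^bold>\<bottom> \<^bold>\<rightarrow> A \<in> IPC"
| MP: "\<lbrakk>A \<^bold>\<rightarrow> B \<in> IPC; A \<in> IPC\<rbrakk> \<Longrightarrow> B \<in> IPC"

text \<open>The inconsistent logic \<^term>\<open>UNIV\<close> is not excluded.\<close>

definition intermediate_logic :: "fm set \<Rightarrow> bool" where
  "intermediate_logic L \<longleftrightarrow>
     IPC \<subseteq> L \<and>
     (\<forall>A B. A \<^bold>\<rightarrow> B \<in> L \<and> A \<in> L \<longrightarrow> B \<in> L) \<and>
     (\<forall>\<sigma> A. A \<in> L \<longrightarrow> subst \<sigma> A \<in> L)"

text \<open>Derivability from hypotheses and theorems of the logic uses modus ponens only: the
  hypotheses are not closed under substitution.\<close>

inductive derives :: "fm set \<Rightarrow> fm set \<Rightarrow> fm \<Rightarrow> bool" for L X where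
  ax: "A \<in> L \<Longrightarrow> derives L X A"
| hyp: "A \<in> X \<Longrightarrow> derives L X A"
| mp: "\<lbrakk>derives L X (A \<^bold>\<rightarrow> B); derives L X A\<rbrakk> \<Longrightarrow> derives L X B"

definition locally_tabular :: "fm set \<Rightarrow> bool" where
  "locally_tabular L \<longleftrightarrow>
     (\<forall>n. finite ({A. vars A \<subseteq> {..<n}} //
       {(A, B). vars A \<subseteq> {..<n} \<and> vars B \<subseteq> {..<n} \<and> A \<^bold>\<leftrightarrow> B \<in> L}))"

definition subst_eq :: "fm set \<Rightarrow> substitution \<Rightarrow> substitution \<Rightarrow> bool" where
  "subst_eq L \<sigma> \<tau> \<longleftrightarrow> (\<forall>x. \<sigma> x \<^bold>\<leftrightarrow> \<tau> x \<in> L)"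

definition unifiers :: "fm set \<Rightarrow> fm \<Rightarrow> substitution set" where
  "unifiers L A = {\<epsilon>. subst \<epsilon> A \<in> L}"

definition unifiable :: "fm set \<Rightarrow> fm \<Rightarrow> bool" where
  "unifiable L A \<longleftrightarrow> unifiers L A \<noteq> {}"

definition more_general :: "fm set \<Rightarrow> substitution \<Rightarrow> substitution \<Rightarrow> bool" where
  "more_general L \<epsilon> \<mu> \<longleftrightarrow> (\<exists>\<alpha>. subst_eq L (subst \<alpha> \<circ> \<epsilon>) \<mu>)"

definition complete_unifiers :: "fm set \<Rightarrow> fm \<Rightarrow> substitution set \<Rightarrow> bool" where
  "complete_unifiers L A U \<longleftrightarrow>
     U \<subseteq> unifiers L A \<and> (\<forall>\<mu>\<in>unifiers L A. \<exists>\<epsilon>\<in>U. more_general L \<epsilon> \<mu>)"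

definition unitary_unification :: "fm set \<Rightarrow> bool" where
  "unitary_unification L \<longleftrightarrow>
     (\<forall>A. unifiable L A \<longrightarrow>
       (\<exists>\<epsilon>\<in>unifiers L A. \<forall>\<mu>\<in>unifiers L A. more_general L \<epsilon> \<mu>))"

definition finitary_unification :: "fm set \<Rightarrow> bool" where
  "finitary_unification L \<longleftrightarrow>
     \<not> unitary_unification L \<and>
     (\<forall>A. unifiable L A \<longrightarrow> (\<exists>U. finite U \<and> complete_unifiers L A U))"

definition projective_unifier :: "fm set \<Rightarrow> fm \<Rightarrow> substitution \<Rightarrow> bool" where
  "projective_unifier L A \<epsilon> \<longleftrightarrow>
     \<epsilon> \<in> unifiers L A \<and> (\<forall>x. derives L {A} (\<epsilon> x \<^bold>\<leftrightarrow> Var x))"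

definition projective_unification :: "fm set \<Rightarrow> bool" where
  "projective_unification L \<longleftrightarrow>
     (\<forall>A. unifiable L A \<longrightarrow> (\<exists>\<epsilon>. projective_unifier L A \<epsilon>))"

end

theory Submission
  imports Defs
begin

text \<open>Let \<open>\<tau>\<close> range over a finite complete set of \<open>L\<close>-unifiers of \<open>A\<close>. Since \<open>L'\<close> contains
  Goedel logic, some \<open>C \<in> L\<close> has, for each \<open>F \<in> L\<close>, an instance that implies \<open>F\<close> in \<open>L'\<close>.
  With disjoint variables in \<open>A(x)\<close>, \<open>\<tau>(y)\<close> and \<open>C(z)\<close>, consider
  \<open>E = A \<and> (C \<rightarrow> \<And>x. x \<leftrightarrow> \<tau> x)\<close>. Every unifier \<open>\<sigma>\<close> of \<open>A\<close> in \<open>L \<inter> L'\<close> that is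
  an \<open>L\<close>-instance of \<open>\<tau>\<close> extends to a unifier of \<open>E\<close>. The substitution
  \<open>\<epsilon> x = (C \<rightarrow> \<tau> x) \<and> (E \<rightarrow> x)\<close> is the identity under \<open>E\<close> and unifies \<open>E\<close> in \<open>L\<close>.
  Composing it with a substitution that is the identity in \<open>L\<close> and a projective unifier of
  \<open>\<epsilon>(E)\<close> in \<open>L'\<close> gives a unifier of \<open>A\<close> in \<open>L \<inter> L'\<close> more general than all such \<open>\<sigma>\<close>.\<close>

section \<open>Theories\<close>

text \<open>Closure under substitution is not demanded, so that hypotheses can be added to a
  logic.\<close>

definition theory_set :: "fm set \<Rightarrow> bool" where
  "theory_set T \<longleftrightarrow> IPC \<subseteq> T \<and> (\<forall>A B. A \<^bold>\<rightarrow> B \<in> T \<longrightarrow> A \<in> T \<longrightarrow> B \<in> T)"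

lemma theory_IPC: "theory_set T \<Longrightarrow> A \<in> IPC \<Longrightarrow> A \<in> T"
  by (auto simp: theory_set_def)

lemma theory_mp: "theory_set T \<Longrightarrow> A \<^bold>\<rightarrow> B \<in> T \<Longrightarrow> A \<in> T \<Longrightarrow> B \<in> T"
  by (auto simp: theory_set_def)

lemma imp_const: "theory_set T \<Longrightarrow> B \<in> T \<Longrightarrow> A \<^bold>\<rightarrow> B \<in> T"
  using theory_mp theory_IPC IPC.K by blast

lemma imp_dist: "theory_set T \<Longrightarrow> A \<^bold>\<rightarrow> B \<^bold>\<rightarrow> C \<in> T \<Longrightarrow> A \<^bold>\<rightarrow> B \<in> T \<Longrightarrow> A \<^bold>\<rightarrow> C \<in> T"
  using theory_mp theory_IPC IPC.S by meson

lemma imp_refl: "theory_set T \<Longrightarrow> A \<^bold>\<rightarrow> A \<in> T"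
  using imp_dist[of T A "A \<^bold>\<rightarrow> A" A] theory_IPC IPC.K by blast

text \<open>This is the deduction theorem: \<open>K\<close> and \<open>S\<close> make the
  consequences of \<open>A\<close> over \<open>T\<close> a theory. Implications can then be proved
  by reasoning about all theories above \<open>T\<close> instead of building Hilbert
  derivations.\<close>

lemma theory_adjoin:
  assumes "theory_set T"
  shows "theory_set {B. A \<^bold>\<rightarrow> B \<in> T}" "T \<subseteq> {B. A \<^bold>\<rightarrow> B \<in> T}" "A \<in> {B. A \<^bold>\<rightarrow> B \<in> T}"
  using assms imp_dist[OF assms] imp_const[OF assms] imp_refl[OF assms] theory_IPC[OF assms]
  unfolding theory_set_def by blast+

lemma impI_theory:
  assumes "theory_set T"
    and "\<And>T'. theory_set T' \<Longrightarrow> T \<subseteq> T' \<Longrightarrow> A \<in> T' \<Longrightarrow> B \<in> T'"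
  shows "A \<^bold>\<rightarrow> B \<in> T"
  using assms(2)[OF theory_adjoin[OF assms(1)]] by simp

lemma imp_trans: "theory_set T \<Longrightarrow> A \<^bold>\<rightarrow> B \<in> T \<Longrightarrow> B \<^bold>\<rightarrow> C \<in> T \<Longrightarrow> A \<^bold>\<rightarrow> C \<in> T"
  using imp_dist imp_const by blast

lemma And_theory: "theory_set T \<Longrightarrow> A \<^bold>\<and> B \<in> T \<longleftrightarrow> A \<in> T \<and> B \<in> T"
  using theory_mp theory_IPC IPC.AndI IPC.AndE1 IPC.AndE2 by meson

lemma Iff_theory: "theory_set T \<Longrightarrow> A \<^bold>\<leftrightarrow> B \<in> T \<longleftrightarrow> A \<^bold>\<rightarrow> B \<in> T \<and> B \<^bold>\<rightarrow> A \<in> T"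
  by (simp add: Iff_def And_theory)

lemma Iff_mem: "theory_set T \<Longrightarrow> A \<^bold>\<leftrightarrow> B \<in> T \<Longrightarrow> A \<in> T \<longleftrightarrow> B \<in> T"
  using Iff_theory theory_mp by blast

lemma Iff_refl: "theory_set T \<Longrightarrow> A \<^bold>\<leftrightarrow> A \<in> T"
  by (simp add: Iff_theory imp_refl)

lemma Iff_sym: "theory_set T \<Longrightarrow> A \<^bold>\<leftrightarrow> B \<in> T \<Longrightarrow> B \<^bold>\<leftrightarrow> A \<in> T"
  by (simp add: Iff_theory)

lemma Iff_trans: "theory_set T \<Longrightarrow> A \<^bold>\<leftrightarrow> B \<in> T \<Longrightarrow> B \<^bold>\<leftrightarrow> C \<in> T \<Longrightarrow> A \<^bold>\<leftrightarrow> C \<in> T"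
  using imp_trans[of T A B C] imp_trans[of T C B A] by (simp add: Iff_theory)

lemma IffI_theory:
  assumes "theory_set T"
    and "\<And>T'. theory_set T' \<Longrightarrow> T \<subseteq> T' \<Longrightarrow> A \<in> T' \<longleftrightarrow> B \<in> T'"
  shows "A \<^bold>\<leftrightarrow> B \<in> T"
  using assms by (auto simp: Iff_theory intro!: impI_theory)

lemma OrI1_theory: "theory_set T \<Longrightarrow> A \<in> T \<Longrightarrow> A \<^bold>\<or> B \<in> T"
  using theory_mp theory_IPC IPC.OrI1 by blast

lemma OrI2_theory: "theory_set T \<Longrightarrow> B \<in> T \<Longrightarrow> A \<^bold>\<or> B \<in> T"
  using theory_mp theory_IPC IPC.OrI2 by blast

lemma Or_imp:
  assumes "theory_set T"
  shows "A \<^bold>\<or> B \<^bold>\<rightarrow> C \<in> T \<longleftrightarrow> A \<^bold>\<rightarrow> C \<in> T \<and> B \<^bold>\<rightarrow> C \<in> T"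
proof
  assume "A \<^bold>\<or> B \<^bold>\<rightarrow> C \<in> T"
  then show "A \<^bold>\<rightarrow> C \<in> T \<and> B \<^bold>\<rightarrow> C \<in> T"
    using imp_trans[OF assms] theory_IPC[OF assms] IPC.OrI1 IPC.OrI2 by blast
next
  assume "A \<^bold>\<rightarrow> C \<in> T \<and> B \<^bold>\<rightarrow> C \<in> T"
  then show "A \<^bold>\<or> B \<^bold>\<rightarrow> C \<in> T"
    using theory_mp[OF assms] theory_IPC[OF assms] IPC.OrE by blast
qed

lemma OrE_theory: "theory_set T \<Longrightarrow> A \<^bold>\<or> B \<in> T \<Longrightarrow> A \<^bold>\<rightarrow> C \<in> T \<Longrightarrow> B \<^bold>\<rightarrow> C \<in> T \<Longrightarrow> C \<in> T"
  using theory_mp Or_imp by blast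

section \<open>Replacement and substitution\<close>

lemma Iff_And_cong:
  assumes "theory_set T" "A \<^bold>\<leftrightarrow> A' \<in> T" "B \<^bold>\<leftrightarrow> B' \<in> T"
  shows "A \<^bold>\<and> B \<^bold>\<leftrightarrow> A' \<^bold>\<and> B' \<in> T"
  using assms by (intro IffI_theory) (auto simp: And_theory dest: Iff_mem subsetD)

lemma Iff_Or_cong:
  assumes "theory_set T" "A \<^bold>\<leftrightarrow> A' \<in> T" "B \<^bold>\<leftrightarrow> B' \<in> T"
  shows "A \<^bold>\<or> B \<^bold>\<leftrightarrow> A' \<^bold>\<or> B' \<in> T"
  using assms theory_IPC[OF assms(1)] IPC.OrI1 IPC.OrI2 imp_trans[OF assms(1)]
  by (simp add: Iff_theory Or_imp) blast

lemma Iff_Imp_cong: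
  assumes "theory_set T" "A \<^bold>\<leftrightarrow> A' \<in> T" "B \<^bold>\<leftrightarrow> B' \<in> T"
  shows "(A \<^bold>\<rightarrow> B) \<^bold>\<leftrightarrow> (A' \<^bold>\<rightarrow> B') \<in> T"
proof (rule IffI_theory[OF assms(1)])
  fix T' assume "theory_set T'" "T \<subseteq> T'"
  then show "A \<^bold>\<rightarrow> B \<in> T' \<longleftrightarrow> A' \<^bold>\<rightarrow> B' \<in> T'"
    using assms(2,3) imp_trans[of T'] Iff_theory[of T'] by blast
qed

lemma subst_cong:
  assumes "theory_set T" "\<And>x. x \<in> vars A \<Longrightarrow> \<sigma> x \<^bold>\<leftrightarrow> \<tau> x \<in> T"
  shows "subst \<sigma> A \<^bold>\<leftrightarrow> subst \<tau> A \<in> T"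
  using assms(2)
  by (induction A) (auto intro!: Iff_And_cong Iff_Or_cong Iff_Imp_cong Iff_refl assms(1))

lemma subst_comp: "subst \<sigma> (subst \<tau> A) = subst (subst \<sigma> \<circ> \<tau>) A"
  by (induction A) auto

lemma subst_fixed: "(\<And>x. x \<in> vars A \<Longrightarrow> \<sigma> x = Var x) \<Longrightarrow> subst \<sigma> A = A"
  by (induction A) auto

lemma subst_Iff [simp]: "subst \<sigma> (A \<^bold>\<leftrightarrow> B) = subst \<sigma> A \<^bold>\<leftrightarrow> subst \<sigma> B"
  by (simp add: Iff_def)

lemma vars_subst: "vars (subst \<sigma> A) = (\<Union>x\<in>vars A. vars (\<sigma> x))"
  by (induction A) auto

lemma finite_vars [simp]: "finite (vars A)"
  by (induction A) auto

lemma logic_theory: "intermediate_logic L \<Longrightarrow> theory_set L"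
  unfolding intermediate_logic_def theory_set_def by blast

lemma logic_subst: "intermediate_logic L \<Longrightarrow> A \<in> L \<Longrightarrow> subst \<sigma> A \<in> L"
  unfolding intermediate_logic_def by blast

lemma logic_Int: "intermediate_logic L \<Longrightarrow> intermediate_logic L' \<Longrightarrow> intermediate_logic (L \<inter> L')"
  unfolding intermediate_logic_def by blast

lemma derives_imp:
  assumes "theory_set L" "derives L {A} B"
  shows "A \<^bold>\<rightarrow> B \<in> L"
  using assms(2)
  by induction (use assms(1) imp_const imp_refl imp_dist in blast)+

primrec big_And :: "fm list \<Rightarrow> fm" where
  "big_And [] = \<^bold>\<bottom> \<^bold>\<rightarrow> \<^bold>\<bottom>"
| "big_And (A # As) = A \<^bold>\<and> big_And As"

lemma big_And_theory: "theory_set T \<Longrightarrow> big_And As \<in> T \<longleftrightarrow> set As \<subseteq> T"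
  by (induction As) (auto simp: And_theory imp_refl)

lemma subst_big_And: "subst \<sigma> (big_And As) = big_And (map (subst \<sigma>) As)"
  by (induction As) auto

section \<open>Prime theories over Goedel logic\<close>

definition prime_theory :: "fm set \<Rightarrow> bool" where
  "prime_theory T \<longleftrightarrow> theory_set T \<and> \<^bold>\<bottom> \<notin> T \<and> (\<forall>A B. A \<^bold>\<or> B \<in> T \<longrightarrow> A \<in> T \<or> B \<in> T)"

text \<open>Zorn's lemma provides a theory maximal among those that extend \<open>T\<close> and omit
  \<open>F\<close>; maximality makes it prime.\<close>

lemma prime_extension:
  assumes "theory_set T" "F \<notin> T"
  obtains T' where "prime_theory T'" "T \<subseteq> T'" "F \<notin> T'"
proof -
  let ?\<A> = "{S. theory_set S \<and> T \<subseteq> S \<and> F \<notin> S}"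
  have "\<exists>M\<in>?\<A>. \<forall>X\<in>?\<A>. M \<subseteq> X \<longrightarrow> X = M"
  proof (rule subset_Zorn_nonempty)
    show "?\<A> \<noteq> {}" using assms by auto
  next
    fix \<C> assume ne: "\<C> \<noteq> {}" and ch: "subset.chain ?\<A> \<C>"
    have sub: "\<C> \<subseteq> ?\<A>" and tot: "\<And>X Y. X \<in> \<C> \<Longrightarrow> Y \<in> \<C> \<Longrightarrow> X \<subseteq> Y \<or> Y \<subseteq> X"
      using ch by (auto simp: subset_chain_def)
    have "B \<in> \<Union>\<C>" if AB: "A \<^bold>\<rightarrow> B \<in> \<Union>\<C>" "A \<in> \<Union>\<C>" for A B
    proof -
      obtain X Y where XY: "X \<in> \<C>" "Y \<in> \<C>" "A \<^bold>\<rightarrow> B \<in> X" "A \<in> Y" using AB by blast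
      then obtain Z where "Z \<in> \<C>" "A \<^bold>\<rightarrow> B \<in> Z" "A \<in> Z" using tot[of X Y] by blast
      then show ?thesis using sub theory_mp by blast
    qed
    then have "theory_set (\<Union>\<C>)"
      using ne sub unfolding theory_set_def by blast
    then show "\<Union>\<C> \<in> ?\<A>" using ne sub by auto
  qed
  then obtain M where M: "theory_set M" "T \<subseteq> M" "F \<notin> M"
    and max: "\<And>X. theory_set X \<Longrightarrow> M \<subseteq> X \<Longrightarrow> F \<notin> X \<Longrightarrow> X = M"
    by fastforce
  \<comment> \<open>Every formula outside \<open>M\<close> implies \<open>F\<close> in
    \<open>M\<close>. A disjunction in \<open>M\<close> with both disjuncts outside would therefore
    put \<open>F\<close> into \<open>M\<close>.\<close>
  have adj: "A \<in> M" if "A \<^bold>\<rightarrow> F \<notin> M" for A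
    using max[of "{B. A \<^bold>\<rightarrow> B \<in> M}"] theory_adjoin[OF M(1), of A] that by auto
  have "prime_theory M"
    unfolding prime_theory_def
    using M adj theory_mp[OF M(1)] theory_IPC[OF M(1)] IPC.BotE OrE_theory[OF M(1)] by blast
  then show ?thesis using that M by blast
qed

definition lc_axiom :: "fm \<Rightarrow> fm \<Rightarrow> fm" where
  "lc_axiom A B = ((A \<^bold>\<rightarrow> B) \<^bold>\<rightarrow> A) \<^bold>\<or> (A \<^bold>\<rightarrow> B)"

definition lc_prime :: "fm set \<Rightarrow> bool" where
  "lc_prime T \<longleftrightarrow> prime_theory T \<and> (\<forall>A B. lc_axiom A B \<in> T)"

text \<open>The projective unifier of \<open>x \<or> (x \<rightarrow> y)\<close> yields \<open>lc_axiom x y\<close>.\<close>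

lemma projective_lc:
  assumes log: "intermediate_logic L" and proj: "projective_unification L"
  shows "lc_axiom A B \<in> L"
proof -
  note th = logic_theory[OF log]
  let ?x = "Var 0" and ?y = "Var 1"
  let ?F = "?x \<^bold>\<or> (?x \<^bold>\<rightarrow> ?y)"
  have "subst (\<lambda>_. \<^bold>\<bottom> \<^bold>\<rightarrow> \<^bold>\<bottom>) ?F \<in> L"
    by (simp add: OrI1_theory[OF th] imp_refl[OF th])
  then obtain \<epsilon> where \<epsilon>: "projective_unifier L ?F \<epsilon>"
    using proj unfolding projective_unification_def unifiable_def unifiers_def by blast
  have un: "\<epsilon> 0 \<^bold>\<or> (\<epsilon> 0 \<^bold>\<rightarrow> \<epsilon> 1) \<in> L"
    using \<epsilon> by (simp add: projective_unifier_def unifiers_def)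
  have eq: "?F \<^bold>\<rightarrow> (\<epsilon> v \<^bold>\<leftrightarrow> Var v) \<in> L" for v
    using \<epsilon> derives_imp[OF th] by (simp add: projective_unifier_def)
  have here: "\<epsilon> v \<in> T \<longleftrightarrow> Var v \<in> T" if "theory_set T" "L \<subseteq> T" "?F \<in> T" for T v
    using eq[of v] that theory_mp Iff_mem by blast
  have "\<epsilon> 0 \<^bold>\<rightarrow> (?x \<^bold>\<rightarrow> ?y) \<^bold>\<rightarrow> ?x \<in> L"
  proof (intro impI_theory th, assumption)
    fix T T' assume "theory_set T'" "L \<subseteq> T" "T \<subseteq> T'" "\<epsilon> 0 \<in> T" "?x \<^bold>\<rightarrow> ?y \<in> T'"
    then show "?x \<in> T'" using here[of T' 0] OrI2_theory by blast
  qed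
  moreover have "(\<epsilon> 0 \<^bold>\<rightarrow> \<epsilon> 1) \<^bold>\<rightarrow> ?x \<^bold>\<rightarrow> ?y \<in> L"
  proof (intro impI_theory th, assumption)
    fix T T' assume *: "theory_set T'" "L \<subseteq> T" "T \<subseteq> T'" "\<epsilon> 0 \<^bold>\<rightarrow> \<epsilon> 1 \<in> T" "?x \<in> T'"
    then have "?F \<in> T'" using OrI1_theory by blast
    then show "?y \<in> T'" using * here[of T' 0] here[of T' 1] theory_mp by blast
  qed
  ultimately have "lc_axiom ?x ?y \<in> L"
    using un OrE_theory[OF th un] imp_trans[OF th] theory_IPC[OF th] IPC.OrI1 IPC.OrI2
    unfolding lc_axiom_def by blast
  from logic_subst[OF log this, of "\<lambda>v. if v = 0 then A else B"]
  show ?thesis by (simp add: lc_axiom_def)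
qed

text \<open>Ordered by provable implication, the formulas modulo such a \<open>T\<close> form a
  nontrivial chain whose top is the class of the members of \<open>T\<close>. The next lemmas
  compute in this chain.\<close>

lemma lc_prime_theory: "lc_prime T \<Longrightarrow> theory_set T"
  by (simp add: lc_prime_def prime_theory_def)

lemma lc_prime_Or: "lc_prime T \<Longrightarrow> A \<^bold>\<or> B \<in> T \<longleftrightarrow> A \<in> T \<or> B \<in> T"
  using OrI1_theory OrI2_theory by (auto simp: lc_prime_def prime_theory_def)

lemma lc_prime_cases: "lc_prime T \<Longrightarrow> A \<^bold>\<rightarrow> B \<in> T \<or> (A \<^bold>\<rightarrow> B) \<^bold>\<rightarrow> A \<in> T"
  using lc_prime_Or[of T "(A \<^bold>\<rightarrow> B) \<^bold>\<rightarrow> A" "A \<^bold>\<rightarrow> B"]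
  unfolding lc_prime_def lc_axiom_def by blast

lemma lc_prime_linear: "lc_prime T \<Longrightarrow> A \<^bold>\<rightarrow> B \<in> T \<or> B \<^bold>\<rightarrow> A \<in> T"
  using lc_prime_cases lc_prime_theory imp_trans theory_IPC IPC.K by meson

lemma lc_prime_imp:
  assumes "lc_prime T" "A \<^bold>\<rightarrow> B \<notin> T"
  shows "(A \<^bold>\<rightarrow> B) \<^bold>\<leftrightarrow> B \<in> T"
  using assms lc_prime_cases[of T A B] lc_prime_theory[of T]
    imp_dist[of T "A \<^bold>\<rightarrow> B" A B] imp_refl theory_IPC IPC.K
  by (auto simp: Iff_theory)

text \<open>In a chain a finite meet equals one of its factors, or the top if there are
  none.\<close>

lemma lc_prime_big_And:
  assumes "lc_prime T"
  shows "big_And As \<in> T \<or> (\<exists>A\<in>set As. A \<^bold>\<rightarrow> big_And As \<in> T)"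
proof (induction As)
  case Nil
  then show ?case using lc_prime_theory[OF assms] imp_refl by simp
next
  case (Cons A As)
  note th = lc_prime_theory[OF assms]
  have meet: "B \<^bold>\<rightarrow> A \<^bold>\<and> big_And As \<in> T" if "B \<^bold>\<rightarrow> A \<in> T" "B \<^bold>\<rightarrow> big_And As \<in> T" for B
    using And_theory[OF theory_adjoin(1)[OF th, of B], of A "big_And As"] that by simp
  from Cons show ?case
  proof (elim disjE bexE)
    assume "big_And As \<in> T"
    then have "A \<^bold>\<rightarrow> A \<^bold>\<and> big_And As \<in> T"
      using meet imp_refl[OF th] imp_const[OF th] by blast
    then show ?thesis by simp
  next
    fix B assume B: "B \<in> set As" "B \<^bold>\<rightarrow> big_And As \<in> T"
    from lc_prime_linear[OF assms] show ?thesis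
    proof
      assume "A \<^bold>\<rightarrow> B \<in> T"
      then have "A \<^bold>\<rightarrow> A \<^bold>\<and> big_And As \<in> T"
        using meet B imp_refl[OF th] imp_trans[OF th] by blast
      then show ?thesis by simp
    next
      assume "B \<^bold>\<rightarrow> A \<in> T"
      then have "B \<^bold>\<rightarrow> A \<^bold>\<and> big_And As \<in> T" using meet B by blast
      then show ?thesis using B(1) by auto
    qed
  qed
qed

section \<open>Finite chains and the levels of a linear quotient\<close>

primrec gval :: "nat \<Rightarrow> (nat \<Rightarrow> nat) \<Rightarrow> fm \<Rightarrow> nat" where
  "gval N e (Var x) = e x"
| "gval N e \<^bold>\<bottom> = 0"
| "gval N e (A \<^bold>\<and> B) = min (gval N e A) (gval N e B)"
| "gval N e (A \<^bold>\<or> B) = max (gval N e A) (gval N e B)"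
| "gval N e (A \<^bold>\<rightarrow> B) = (if gval N e A \<le> gval N e B then N else gval N e B)"

lemma gval_le: "(\<And>x. x \<in> vars A \<Longrightarrow> e x \<le> N) \<Longrightarrow> gval N e A \<le> N"
  by (induction A) auto

text \<open>Failure in the Goedel chain with values \<open>0\<close> to \<open>N\<close>, where
  \<open>N\<close> is the designated top.\<close>

definition refutable :: "nat \<Rightarrow> fm \<Rightarrow> bool" where
  "refutable N A \<longleftrightarrow> (\<exists>e. (\<forall>x\<in>vars A. e x \<le> N) \<and> gval N e A < N)"

lemma gval_chain:
  assumes T: "lc_prime T"
    and a: "a 0 = \<^bold>\<bottom>" "a N \<in> T"
    and mono: "\<And>i j. i \<le> j \<Longrightarrow> j \<le> N \<Longrightarrow> a i \<^bold>\<rightarrow> a j \<in> T"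
    and strict: "\<And>i j. i < j \<Longrightarrow> j \<le> N \<Longrightarrow> a j \<^bold>\<rightarrow> a i \<notin> T"
    and e: "\<And>x. x \<in> vars A \<Longrightarrow> e x \<le> N \<and> \<nu> x \<^bold>\<leftrightarrow> a (e x) \<in> T"
  shows "subst \<nu> A \<^bold>\<leftrightarrow> a (gval N e A) \<in> T"
  using e
proof (induction A)
  case Bot
  then show ?case by (simp add: a Iff_refl lc_prime_theory[OF T])
next
  case (And A B)
  note th = lc_prime_theory[OF T]
  have le: "gval N e A \<le> N" "gval N e B \<le> N" using And.prems by (auto intro: gval_le)
  have "a i \<^bold>\<and> a j \<^bold>\<leftrightarrow> a (min i j) \<in> T" if "i \<le> N" "j \<le> N" for i j
  proof (rule IffI_theory[OF th])
    fix T' assume "theory_set T'" "T \<subseteq> T'"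
    then show "a i \<^bold>\<and> a j \<in> T' \<longleftrightarrow> a (min i j) \<in> T'"
      using mono[of i j] mono[of j i] that theory_mp[of T']
      by (cases "i \<le> j") (auto simp: And_theory min_def)
  qed
  from this[OF le] show ?case
    using And Iff_trans[OF th] Iff_And_cong[OF th] by (simp; blast)
next
  case (Or A B)
  note th = lc_prime_theory[OF T]
  have le: "gval N e A \<le> N" "gval N e B \<le> N" using Or.prems by (auto intro: gval_le)
  have "a i \<^bold>\<or> a j \<^bold>\<leftrightarrow> a (max i j) \<in> T" if "i \<le> N" "j \<le> N" for i j
    using mono[of i j] mono[of j i] that theory_IPC[OF th] IPC.OrI1 IPC.OrI2
    by (cases "i \<le> j") (auto simp: Iff_theory[OF th] Or_imp[OF th] max_def imp_refl[OF th])
  from this[OF le] show ?case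
    using Or Iff_trans[OF th] Iff_Or_cong[OF th] by (simp; blast)
next
  case (Imp A B)
  note th = lc_prime_theory[OF T]
  have le: "gval N e A \<le> N" "gval N e B \<le> N" using Imp.prems by (auto intro: gval_le)
  have "(a i \<^bold>\<rightarrow> a j) \<^bold>\<leftrightarrow> a (if i \<le> j then N else j) \<in> T" if "i \<le> N" "j \<le> N" for i j
  proof (cases "i \<le> j")
    case True
    then show ?thesis using mono[of i j] that a imp_const[OF th] by (auto simp: Iff_theory[OF th])
  next
    case False
    then show ?thesis using strict[of j i] that lc_prime_imp[OF T] by auto
  qed
  from this[OF le] show ?case
    using Imp Iff_trans[OF th] Iff_Imp_cong[OF th] by (simp only: subst.simps gval.simps vars.simps Un_iff) blast
qed simp

text \<open>In a chain, \<open>level xs i\<close> is the \<open>i\<close>-th smallest value above \<open>\<bottom>\<close> of the variables in \<open>xs\<close>,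
  or \<open>\<top>\<close> when there are fewer.\<close>

primrec level :: "nat list \<Rightarrow> nat \<Rightarrow> fm" where
  "level xs 0 = \<^bold>\<bottom>"
| "level xs (Suc i) = big_And (map (\<lambda>x. Var x \<^bold>\<or> (Var x \<^bold>\<rightarrow> level xs i)) xs)"

context
  fixes T and xs :: "nat list"
  assumes T: "lc_prime T"
begin

private lemmas th = lc_prime_theory[OF T]

lemma level_mono: "i \<le> j \<Longrightarrow> level xs i \<^bold>\<rightarrow> level xs j \<in> T"
proof (induction rule: dec_induct)
  case base
  then show ?case using imp_refl th by blast
next
  case (step j)
  have "level xs j \<^bold>\<rightarrow> level xs (Suc j) \<in> T"
  proof (rule impI_theory[OF th])
    fix T' assume T': "theory_set T'" "level xs j \<in> T'"
    then show "level xs (Suc j) \<in> T'"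
      using OrI2_theory[OF T'(1)] imp_const[OF T'] by (auto simp: big_And_theory)
  qed
  then show ?case using step imp_trans[OF th] by blast
qed

text \<open>The meet defining the next level is attained at some conjunct. The conjunct of
  \<open>x\<close> is the top unless \<open>x\<close> lies strictly above level \<open>i\<close>,
  and then it is equivalent to \<open>x\<close>.\<close>

lemma level_next:
  assumes "level xs (Suc i) \<notin> T"
  obtains x where "x \<in> set xs" "Var x \<^bold>\<rightarrow> level xs (Suc i) \<in> T" "Var x \<^bold>\<rightarrow> level xs i \<notin> T"
proof -
  obtain x where "x \<in> set xs" "Var x \<^bold>\<or> (Var x \<^bold>\<rightarrow> level xs i) \<^bold>\<rightarrow> level xs (Suc i) \<in> T"
    using lc_prime_big_And[OF T, of "map (\<lambda>x. Var x \<^bold>\<or> (Var x \<^bold>\<rightarrow> level xs i)) xs"] assms by auto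
  then show ?thesis using that assms theory_mp[OF th] unfolding Or_imp[OF th] by blast
qed

lemma level_strict:
  assumes "level xs i \<notin> T" "i < j"
  shows "level xs j \<^bold>\<rightarrow> level xs i \<notin> T"
proof
  assume "level xs j \<^bold>\<rightarrow> level xs i \<in> T"
  then have *: "level xs (Suc i) \<^bold>\<rightarrow> level xs i \<in> T"
    using level_mono[of "Suc i" j] assms(2) imp_trans[OF th] by auto
  then have "level xs (Suc i) \<notin> T" using assms(1) theory_mp[OF th] by blast
  then show False using level_next imp_trans[OF th] * by metis
qed

lemma level_gap:
  assumes "x \<in> set xs" "Var x \<^bold>\<rightarrow> level xs i \<notin> T"
  shows "level xs (Suc i) \<^bold>\<rightarrow> Var x \<in> T"
proof (rule imp_trans[OF th])
  show "level xs (Suc i) \<^bold>\<rightarrow> Var x \<^bold>\<or> (Var x \<^bold>\<rightarrow> level xs i) \<in> T"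
    using assms(1) by (intro impI_theory[OF th]) (auto simp: big_And_theory)
  show "Var x \<^bold>\<or> (Var x \<^bold>\<rightarrow> level xs i) \<^bold>\<rightarrow> Var x \<in> T"
    using assms(2) lc_prime_cases[OF T] imp_refl[OF th] by (auto simp: Or_imp[OF th])
qed

text \<open>Each step that stays below the top passes a new variable of \<open>xs\<close>, and there
  are only finitely many.\<close>

lemma level_top: "\<exists>i. level xs i \<in> T"
proof (rule ccontr)
  assume *: "\<nexists>i. level xs i \<in> T"
  then have "\<forall>i. \<exists>x. x \<in> set xs \<and> Var x \<^bold>\<rightarrow> level xs (Suc i) \<in> T \<and> Var x \<^bold>\<rightarrow> level xs i \<notin> T"
    using level_next by metis
  then obtain f where f: "\<And>i. f i \<in> set xs" "\<And>i. Var (f i) \<^bold>\<rightarrow> level xs (Suc i) \<in> T"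
    "\<And>i. Var (f i) \<^bold>\<rightarrow> level xs i \<notin> T" by metis
  \<comment> \<open>\<open>Var (f i)\<close> is at most level \<open>Suc i\<close>, hence at most
    level \<open>j\<close>, while \<open>Var (f j)\<close> is not.\<close>
  have "f i \<noteq> f j" if "i < j" for i j
    using f(2)[of i] f(3)[of j] level_mono[of "Suc i" j] that imp_trans[OF th]
    by (metis Suc_leI)
  then have "inj f" by (metis injI linorder_neqE_nat)
  moreover have "range f \<subseteq> set xs" using f(1) by blast
  ultimately show False
    using finite_subset[OF _ finite_set] finite_imageD infinite_UNIV_nat by blast
qed

text \<open>At the least level that bounds \<open>x\<close>, the preceding level does not bound it,
  so \<open>level_gap\<close> gives the reverse implication.\<close>

lemma level_value:
  assumes "x \<in> set xs" "level xs N \<in> T"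
  shows "\<exists>i\<le>N. Var x \<^bold>\<leftrightarrow> level xs i \<in> T"
proof -
  let ?P = "\<lambda>i. Var x \<^bold>\<rightarrow> level xs i \<in> T"
  let ?i = "LEAST i. ?P i"
  have P: "?P N" using assms(2) imp_const[OF th] by blast
  have i: "?P ?i" "?i \<le> N" using LeastI[of ?P, OF P] Least_le[of ?P, OF P] by auto
  have "level xs ?i \<^bold>\<rightarrow> Var x \<in> T"
  proof (cases ?i)
    case 0
    then show ?thesis using theory_IPC[OF th] IPC.BotE by simp
  next
    case (Suc k)
    then have "\<not> ?P k" using not_less_Least[of k ?P] by simp
    then show ?thesis using level_gap assms(1) Suc by simp
  qed
  then show ?thesis using i by (auto simp: Iff_theory[OF th])
qed

text \<open>Stopping at the first level that is in \<open>T\<close> gives strictly increasing levels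
  that contain the values of all variables of \<open>F\<close>. Reading off these values as a
  valuation makes \<open>F\<close> fail.\<close>

lemma refutable_level:
  assumes F: "vars F \<subseteq> set xs" "F \<notin> T" and N: "level xs N \<in> T"
  shows "\<exists>M\<le>N. refutable M F"
proof -
  let ?M = "LEAST i. level xs i \<in> T"
  have M: "level xs ?M \<in> T" "?M \<le> N" and less: "\<And>i. i < ?M \<Longrightarrow> level xs i \<notin> T"
    using LeastI[of "\<lambda>i. level xs i \<in> T", OF N] Least_le[of "\<lambda>i. level xs i \<in> T", OF N]
      not_less_Least by auto
  have "\<forall>x. \<exists>i. x \<in> set xs \<longrightarrow> i \<le> ?M \<and> Var x \<^bold>\<leftrightarrow> level xs i \<in> T"
    using level_value M by blast
  then obtain e where e: "\<And>x. x \<in> set xs \<Longrightarrow> e x \<le> ?M \<and> Var x \<^bold>\<leftrightarrow> level xs (e x) \<in> T"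
    by metis
  have "subst Var F \<^bold>\<leftrightarrow> level xs (gval ?M e F) \<in> T"
    using e F(1) M level_mono level_strict less
    by (intro gval_chain[OF T]) (auto 4 3)
  then have "level xs (gval ?M e F) \<notin> T"
    using F(2) Iff_mem[OF th] by (simp add: subst_fixed)
  then have "gval ?M e F \<noteq> ?M" using M by metis
  moreover have "gval ?M e F \<le> ?M" using e F(1) by (intro gval_le) auto
  ultimately have "refutable ?M F" using e F(1) unfolding refutable_def by (intro exI[of _ e]) auto
  then show ?thesis using M(2) by blast
qed

end

text \<open>\<open>C\<close> is a member of \<open>S\<close> refutable on the shortest chain.\<close>

lemma exists_strongest:
  assumes th: "theory_set L" and lc: "\<And>A B. lc_axiom A B \<in> L" and "S \<noteq> {}"
  obtains C where "C \<in> S" "\<And>F. F \<in> S \<Longrightarrow> \<exists>\<nu>. subst \<nu> C \<^bold>\<rightarrow> F \<in> L"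
proof (cases "\<exists>N. \<exists>C\<in>S. refutable N C")
  case False
  \<comment> \<open>Completeness with respect to finite chains: if no member of \<open>S\<close> is
    refutable, all of them lie in \<open>L\<close> and any \<open>C\<close> will do.\<close>
  have "F \<in> L" if F: "F \<in> S" for F
  proof (rule ccontr)
    assume "F \<notin> L"
    then obtain T where T: "prime_theory T" "L \<subseteq> T" "F \<notin> T"
      using prime_extension[OF th] by blast
    then have lcT: "lc_prime T" using lc by (simp add: lc_prime_def subset_iff)
    obtain xs where "set xs = vars F" using finite_list[OF finite_vars] by blast
    then obtain N where "refutable N F"
      using level_top[OF lcT, of xs] refutable_level[OF lcT, of F xs] T(3) by blast
    then show False using False F by blast
  qed
  moreover obtain C where "C \<in> S" using \<open>S \<noteq> {}\<close> by blast
  ultimately show ?thesis using that[of C] imp_const[OF th] by blast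
next
  case True
  define N where "N = (LEAST N. \<exists>C\<in>S. refutable N C)"
  obtain C where C: "C \<in> S" "refutable N C"
    using LeastI_ex[OF True] unfolding N_def by blast
  have min: "N \<le> M" if "F \<in> S" "refutable M F" for M F
    using that unfolding N_def by (intro Least_le) auto
  obtain e where e: "\<And>x. x \<in> vars C \<Longrightarrow> e x \<le> N" "gval N e C < N"
    using C(2) by (auto simp: refutable_def)
  have "\<exists>\<nu>. subst \<nu> C \<^bold>\<rightarrow> F \<in> L" if F: "F \<in> S" for F
  proof -
    obtain xs where xs: "set xs = vars F" using finite_list[OF finite_vars] by blast
    \<comment> \<open>The refuting values of \<open>C\<close> are replaced by levels of the
      variables of \<open>F\<close>, with the top value \<open>N\<close> sent to a theorem. Wherever
      \<open>F\<close> fails, this instance of \<open>C\<close> should fail too.\<close>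
    define a where "a i = (if i < N then level xs i else \<^bold>\<bottom> \<^bold>\<rightarrow> \<^bold>\<bottom>)" for i
    have "subst (a \<circ> e) C \<^bold>\<rightarrow> F \<in> L"
    proof (rule ccontr)
      assume "subst (a \<circ> e) C \<^bold>\<rightarrow> F \<notin> L"
      then obtain T where T: "prime_theory T" "{B. subst (a \<circ> e) C \<^bold>\<rightarrow> B \<in> L} \<subseteq> T" "F \<notin> T"
        using prime_extension theory_adjoin[OF th] by (metis mem_Collect_eq)
      then have L: "L \<subseteq> T" "subst (a \<circ> e) C \<in> T"
        using theory_adjoin[OF th, of "subst (a \<circ> e) C"] by auto
      then have lcT: "lc_prime T" using lc T by (simp add: lc_prime_def subset_iff)
      note thT = lc_prime_theory[OF lcT]
      \<comment> \<open>A level below \<open>N\<close> in \<open>T\<close> would refute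
        \<open>F\<close> on a chain shorter than the minimal one.\<close>
      have no: "level xs i \<notin> T" if "i < N" for i
        using refutable_level[OF lcT, of F xs i] xs T(3) min[OF F] that by fastforce
      have top: "\<^bold>\<bottom> \<^bold>\<rightarrow> \<^bold>\<bottom> \<in> T" using imp_refl thT by blast
      have "subst (a \<circ> e) C \<^bold>\<leftrightarrow> a (gval N e C) \<in> T"
      proof (rule gval_chain[OF lcT])
        show "a 0 = \<^bold>\<bottom>" using e(2) by (simp add: a_def)
        show "a N \<in> T" using top by (simp add: a_def)
        show "a i \<^bold>\<rightarrow> a j \<in> T" if "i \<le> j" "j \<le> N" for i j
          using that level_mono[OF lcT] imp_const[OF thT top] by (auto simp: a_def)
        show "a j \<^bold>\<rightarrow> a i \<notin> T" if "i < j" "j \<le> N" for i j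
          using that level_strict[OF lcT] no theory_mp[OF thT _ top, of "level xs i"]
          by (auto simp: a_def)
        show "e x \<le> N \<and> (a \<circ> e) x \<^bold>\<leftrightarrow> a (e x) \<in> T" if "x \<in> vars C" for x
          using that e(1) Iff_refl[OF thT] by simp
      qed
      then show False
        using Iff_mem[OF thT] L(2) e(2) no[of "gval N e C"] by (auto simp: a_def)
    qed
    then show ?thesis by blast
  qed
  then show ?thesis using that C(1) by blast
qed

section \<open>Gluing unifiers\<close>

text \<open>Modulo \<open>L\<close> the unifier \<open>\<rho>\<close> is the identity, modulo \<open>L'\<close> it is a projective unifier of
  \<open>G\<close>; since \<open>G \<in> L\<close>, both agree modulo the join of \<open>L\<close> and \<open>L'\<close>.\<close>

lemma glue_projective:
  assumes L: "intermediate_logic L" and L': "intermediate_logic L'"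
    and proj: "projective_unification L'"
    and G: "G \<in> L" and "unifiable L' G"
  obtains \<rho> where "\<rho> \<in> unifiers (L \<inter> L') G"
    and "\<And>\<mu>. \<mu> \<in> unifiers L' G \<Longrightarrow> subst_eq (L \<inter> L') (subst \<mu> \<circ> \<rho>) \<mu>"
proof -
  note th = logic_theory[OF L] and th' = logic_theory[OF L']
  obtain \<epsilon> where \<epsilon>: "projective_unifier L' G \<epsilon>"
    using proj assms(5) by (auto simp: projective_unification_def)
  define H where "H v = (G \<^bold>\<rightarrow> (\<epsilon> v \<^bold>\<leftrightarrow> Var v))" for v
  \<comment> \<open>In \<open>L\<close>, \<open>G\<close> is a theorem, so the first conjunct is
    \<open>Var v\<close> and implies the second. In \<open>L'\<close>, \<open>H v\<close> is a
    theorem, so the second conjunct is \<open>\<epsilon> v\<close> and implies the first.\<close>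
  define \<rho> where "\<rho> v = (G \<^bold>\<rightarrow> Var v) \<^bold>\<and> (H v \<^bold>\<rightarrow> \<epsilon> v)" for v
  have H: "H v \<in> L'" for v
    using \<epsilon> derives_imp[OF th'] by (auto simp: H_def projective_unifier_def)
  have in_L: "\<rho> v \<^bold>\<leftrightarrow> Var v \<in> L" for v
  proof (rule IffI_theory[OF th])
    fix T assume T: "theory_set T" "L \<subseteq> T"
    have "H v \<^bold>\<rightarrow> \<epsilon> v \<in> T" if "Var v \<in> T"
    proof (rule impI_theory[OF T(1)])
      fix T' assume "theory_set T'" "T \<subseteq> T'" "H v \<in> T'"
      then show "\<epsilon> v \<in> T'"
        using that G T(2) theory_mp Iff_mem unfolding H_def by blast
    qed
    then show "\<rho> v \<in> T \<longleftrightarrow> Var v \<in> T"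
      using theory_mp[OF T(1), of G] imp_const[OF T(1), of "Var v" G] G T(2)
      unfolding \<rho>_def And_theory[OF T(1)] by blast
  qed
  have in_L': "\<rho> v \<^bold>\<leftrightarrow> \<epsilon> v \<in> L'" for v
  proof (rule IffI_theory[OF th'])
    fix T assume T: "theory_set T" "L' \<subseteq> T"
    have "G \<^bold>\<rightarrow> Var v \<in> T" if "\<epsilon> v \<in> T"
    proof (rule impI_theory[OF T(1)])
      fix T' assume "theory_set T'" "T \<subseteq> T'" "G \<in> T'"
      then show "Var v \<in> T'"
        using that H[of v] T(2) theory_mp Iff_mem unfolding H_def by blast
    qed
    then show "\<rho> v \<in> T \<longleftrightarrow> \<epsilon> v \<in> T"
      using theory_mp[OF T(1), of "H v"] imp_const[OF T(1), of "\<epsilon> v" "H v"] H[of v] T(2)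
      unfolding \<rho>_def And_theory[OF T(1)] by blast
  qed
  have "subst \<rho> G \<in> L"
    using subst_cong[OF th, of G \<rho> Var, OF in_L] Iff_mem[OF th] G by (simp add: subst_fixed)
  moreover have "subst \<rho> G \<in> L'"
    using subst_cong[OF th', of G \<rho> \<epsilon>, OF in_L'] Iff_mem[OF th'] \<epsilon>
    by (auto simp: projective_unifier_def unifiers_def)
  moreover have "subst_eq (L \<inter> L') (subst \<mu> \<circ> \<rho>) \<mu>" if "\<mu> \<in> unifiers L' G" for \<mu>
  proof -
    have "subst \<mu> (\<rho> v) \<^bold>\<leftrightarrow> \<mu> v \<in> L" for v
      using logic_subst[OF L in_L, of \<mu> v] by simp
    moreover have "subst \<mu> (\<rho> v) \<^bold>\<leftrightarrow> \<mu> v \<in> L'" for v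
    proof -
      have "subst \<mu> (\<epsilon> v) \<^bold>\<leftrightarrow> \<mu> v \<in> L'"
        using logic_subst[OF L' H, of \<mu> v] that theory_mp[OF th']
        by (auto simp: H_def unifiers_def)
      then show ?thesis
        using logic_subst[OF L' in_L', of \<mu> v] Iff_trans[OF th'] by simp
    qed
    ultimately show ?thesis by (simp add: subst_eq_def)
  qed
  ultimately show ?thesis using that by (simp add: unifiers_def)
qed

text \<open>The formula to which \<open>glue_projective\<close> is applied uses three disjoint copies of the
  variables: \<open>3x\<close> for the variables of \<open>A\<close>, \<open>3x + 1\<close> for those in the range of \<open>\<tau>\<close>, and
  \<open>3x + 2\<close> for those of \<open>C\<close>.\<close>

lemma lift_unifier:
  assumes L: "intermediate_logic L" and L': "intermediate_logic L'"
    and proj: "projective_unification L'"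
    and C: "C \<in> L" "\<And>F. F \<in> L \<Longrightarrow> \<exists>\<nu>. subst \<nu> C \<^bold>\<rightarrow> F \<in> L'"
    and \<tau>: "\<tau> \<in> unifiers L A"
  shows "\<exists>\<rho>. \<forall>\<sigma>\<in>unifiers (L \<inter> L') A. more_general L \<tau> \<sigma> \<longrightarrow>
    \<rho> \<in> unifiers (L \<inter> L') A \<and> more_general (L \<inter> L') \<rho> \<sigma>"
proof -
  note th = logic_theory[OF L] and th' = logic_theory[OF L']
  note log = logic_Int[OF L L']
  note thI = logic_theory[OF log]
  obtain xs where xs: "set xs = vars A" using finite_list[OF finite_vars] by blast
  define t where "t = (\<lambda>x. subst (\<lambda>y. Var (3 * y + 1)) (\<tau> x))"
  define A3 where "A3 = subst (\<lambda>x. Var (3 * x)) A"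
  define C3 where "C3 = subst (\<lambda>z. Var (3 * z + 2)) C"
  define D where "D = big_And (map (\<lambda>x. Var (3 * x) \<^bold>\<leftrightarrow> t x) xs)"
  define E where "E = A3 \<^bold>\<and> (C3 \<^bold>\<rightarrow> D)"
  \<comment> \<open>Only the copies of variables of \<open>A\<close> are changed, since
    \<open>D\<close> constrains no others. The rest stay free, so that substitutions can be compared
    on all variables.\<close>
  define \<epsilon> where "\<epsilon> w = (if w mod 3 = 0 \<and> w div 3 \<in> vars A
    then (C3 \<^bold>\<rightarrow> t (w div 3)) \<^bold>\<and> (E \<^bold>\<rightarrow> Var w) else Var w)" for w
  have D_mem: "D \<in> T \<longleftrightarrow> (\<forall>x\<in>vars A. Var (3 * x) \<^bold>\<leftrightarrow> t x \<in> T)" if "theory_set T" for T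
    using that by (auto simp: D_def big_And_theory xs)
  have D_subst: "subst \<mu> D \<in> T \<longleftrightarrow> (\<forall>x\<in>vars A. \<mu> (3 * x) \<^bold>\<leftrightarrow> subst \<mu> (t x) \<in> T)"
    if "theory_set T" for T \<mu>
    using that by (auto simp: D_def subst_big_And big_And_theory xs)
  have EC: "Var (3 * x) \<in> T \<longleftrightarrow> t x \<in> T" if "theory_set T" "E \<in> T" "C3 \<in> T" "x \<in> vars A" for T x
  proof (rule Iff_mem)
    have "D \<in> T" using that theory_mp And_theory unfolding E_def by blast
    then show "Var (3 * x) \<^bold>\<leftrightarrow> t x \<in> T" using that D_mem by blast
  qed (rule that)
  have \<epsilon>_E: "E \<^bold>\<rightarrow> (\<epsilon> w \<^bold>\<leftrightarrow> Var w) \<in> L \<inter> L'" for w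
  proof (cases "w mod 3 = 0 \<and> w div 3 \<in> vars A")
    case True
    then obtain x where x: "w = 3 * x" "x \<in> vars A" by auto
    then have \<epsilon>w: "\<epsilon> w = (C3 \<^bold>\<rightarrow> t x) \<^bold>\<and> (E \<^bold>\<rightarrow> Var w)" by (simp add: \<epsilon>_def)
    show ?thesis
    proof (rule impI_theory[OF thI], rule IffI_theory, assumption)
      fix T S assume T: "E \<in> T" and S: "theory_set S" "T \<subseteq> S"
      have "C3 \<^bold>\<rightarrow> t x \<in> S" if "Var w \<in> S"
      proof (rule impI_theory[OF S(1)])
        fix S' assume S': "theory_set S'" "S \<subseteq> S'" "C3 \<in> S'"
        then show "t x \<in> S'" using EC[of S' x] T S(2) x that by blast
      qed
      then show "\<epsilon> w \<in> S \<longleftrightarrow> Var w \<in> S"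
        using theory_mp[OF S(1), of E] imp_const[OF S(1), of "Var w" E] T S(2)
        unfolding \<epsilon>w And_theory[OF S(1)] by blast
    qed
  next
    case False
    then show ?thesis using imp_const[OF thI] Iff_refl[OF thI] by (simp only: \<epsilon>_def if_False)
  qed
  have C3: "C3 \<in> L" using logic_subst[OF L C(1)] by (simp add: C3_def)
  \<comment> \<open>As \<open>C3\<close> is a theorem of \<open>L\<close>, the first conjunct
    reduces to \<open>t x\<close>; under \<open>E\<close> it is equivalent to the variable, so the
    second conjunct follows.\<close>
  have \<epsilon>_L: "\<epsilon> (3 * x) \<^bold>\<leftrightarrow> t x \<in> L" if x: "x \<in> vars A" for x
  proof (rule IffI_theory[OF th])
    fix T assume T: "theory_set T" "L \<subseteq> T"
    have "E \<^bold>\<rightarrow> Var (3 * x) \<in> T" if "t x \<in> T"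
    proof (rule impI_theory[OF T(1)])
      fix S assume "theory_set S" "T \<subseteq> S" "E \<in> S"
      then show "Var (3 * x) \<in> S" using EC[of S x] T C3 x that by blast
    qed
    moreover have "\<epsilon> (3 * x) = (C3 \<^bold>\<rightarrow> t x) \<^bold>\<and> (E \<^bold>\<rightarrow> Var (3 * x))"
      using x by (simp add: \<epsilon>_def)
    ultimately show "\<epsilon> (3 * x) \<in> T \<longleftrightarrow> t x \<in> T"
      using theory_mp[OF T(1), of C3] imp_const[OF T(1), of "t x" C3] C3 T(2)
      by (simp add: And_theory[OF T(1)]) blast
  qed
  have \<epsilon>_t: "subst \<epsilon> (t x) = t x" for x
  proof (rule subst_fixed)
    fix w assume "w \<in> vars (t x)"
    then obtain y where "w = Suc (3 * y)" by (auto simp: t_def vars_subst)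
    then have "w mod 3 = 1" by presburger
    then show "\<epsilon> w = Var w" by (simp add: \<epsilon>_def)
  qed
  define G where "G = subst \<epsilon> E"
  have "subst t A \<in> L"
    using logic_subst[OF L, of "subst \<tau> A" "\<lambda>y. Var (3 * y + 1)"] \<tau>
    by (simp add: unifiers_def subst_comp t_def comp_def)
  then have "subst \<epsilon> A3 \<in> L"
    using Iff_mem[OF th] subst_cong[OF th, of A "\<lambda>x. \<epsilon> (3 * x)" t] \<epsilon>_L
    by (simp add: A3_def subst_comp comp_def)
  moreover have "subst \<epsilon> D \<in> L" using \<epsilon>_L by (simp add: D_subst[OF th] \<epsilon>_t)
  ultimately have G: "G \<in> L"
    using imp_const[OF th] by (simp add: G_def E_def And_theory[OF th])
  have lift: "\<exists>\<mu>. \<mu> \<in> unifiers L' G \<and> (\<forall>x. subst \<mu> (\<epsilon> (3 * x)) \<^bold>\<leftrightarrow> \<sigma> x \<in> L \<inter> L')"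
    if \<sigma>: "\<sigma> \<in> unifiers (L \<inter> L') A" "more_general L \<tau> \<sigma>" for \<sigma>
  proof -
    obtain \<alpha> where \<alpha>: "\<And>x. subst \<alpha> (\<tau> x) \<^bold>\<leftrightarrow> \<sigma> x \<in> L"
      using \<sigma>(2) by (auto simp: more_general_def subst_eq_def)
    \<comment> \<open>The three copies receive \<open>\<sigma>\<close>, the witness
      \<open>\<alpha>\<close> of generality, and \<open>\<nu>\<close>. The parameter
      \<open>\<nu>\<close> is kept open because it is chosen from the image \<open>F\<close> of
      \<open>D\<close>, which does not depend on it.\<close>
    define \<mu>0 where "\<mu>0 \<nu> w = (if w mod 3 = 0 then \<sigma> (w div 3)
      else if w mod 3 = 1 then \<alpha> (w div 3) else \<nu> (w div 3))" for \<nu> w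
    have \<mu>0: "\<mu>0 \<nu> (3 * x) = \<sigma> x" "\<mu>0 \<nu> (Suc (3 * x)) = \<alpha> x"
      "\<mu>0 \<nu> (Suc (Suc (3 * x))) = \<nu> x" for \<nu> x
    proof -
      have "Suc (3 * x) mod 3 = 1" "Suc (3 * x) div 3 = x"
        "Suc (Suc (3 * x)) mod 3 = 2" "Suc (Suc (3 * x)) div 3 = x"
        by presburger+
      then show "\<mu>0 \<nu> (3 * x) = \<sigma> x" "\<mu>0 \<nu> (Suc (3 * x)) = \<alpha> x"
        "\<mu>0 \<nu> (Suc (Suc (3 * x))) = \<nu> x"
        by (simp_all add: \<mu>0_def)
    qed
    have \<mu>0_t: "subst (\<mu>0 \<nu>) (t x) = subst \<alpha> (\<tau> x)" for \<nu> x
      by (simp add: t_def subst_comp comp_def \<mu>0)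
    define F where "F = big_And (map (\<lambda>x. \<sigma> x \<^bold>\<leftrightarrow> subst \<alpha> (\<tau> x)) xs)"
    have \<mu>0_D: "subst (\<mu>0 \<nu>) D = F" for \<nu>
      by (simp add: D_def F_def subst_big_And comp_def \<mu>0 \<mu>0_t)
    have F: "F \<in> L" using \<alpha> Iff_sym[OF th] by (auto simp: F_def big_And_theory[OF th])
    then obtain \<nu> where \<nu>: "subst \<nu> C \<^bold>\<rightarrow> F \<in> L'" using C(2) by blast
    define \<mu> where "\<mu> = \<mu>0 \<nu>"
    have "subst \<mu> C3 \<^bold>\<rightarrow> subst \<mu> D \<in> L \<inter> L'"
      using \<nu> imp_const[OF th F] by (simp add: \<mu>_def \<mu>0_D C3_def subst_comp comp_def \<mu>0)
    moreover have "subst \<mu> A3 \<in> L \<inter> L'"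
      using \<sigma>(1) by (simp add: \<mu>_def A3_def subst_comp comp_def \<mu>0 unifiers_def)
    ultimately have \<mu>E: "subst \<mu> E \<in> L \<inter> L'"
      by (simp only: E_def subst.simps And_theory[OF thI] simp_thms)
    \<comment> \<open>\<open>\<epsilon>\<close> is the identity under \<open>E\<close> and
      \<open>\<mu>\<close> unifies \<open>E\<close>, so composing with \<open>\<epsilon>\<close>
      does not change \<open>\<mu>\<close>.\<close>
    have \<mu>\<epsilon>: "subst \<mu> (\<epsilon> w) \<^bold>\<leftrightarrow> \<mu> w \<in> L \<inter> L'" for w
    proof (rule theory_mp[OF thI _ \<mu>E])
      show "subst \<mu> E \<^bold>\<rightarrow> (subst \<mu> (\<epsilon> w) \<^bold>\<leftrightarrow> \<mu> w) \<in> L \<inter> L'"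
        using logic_subst[OF log \<epsilon>_E, of \<mu> w] by (simp only: subst.simps subst_Iff)
    qed
    then have "subst \<mu> G \<^bold>\<leftrightarrow> subst \<mu> E \<in> L \<inter> L'"
      unfolding G_def subst_comp by (intro subst_cong[OF thI]) simp
    then have "\<mu> \<in> unifiers L' G"
      using \<mu>E Iff_mem[OF thI] by (auto simp: unifiers_def)
    moreover have "subst \<mu> (\<epsilon> (3 * x)) \<^bold>\<leftrightarrow> \<sigma> x \<in> L \<inter> L'" for x
      using \<mu>\<epsilon>[of "3 * x"] by (simp only: \<mu>_def \<mu>0)
    ultimately show ?thesis by blast
  qed
  show ?thesis
  proof (cases "unifiable L' G")
    \<comment> \<open>Every \<open>\<sigma>\<close> in question would give an
      \<open>L'\<close>-unifier of \<open>G\<close>, so here there is none and the claim is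
      vacuous.\<close>
    case False
    then show ?thesis using lift by (auto simp: unifiable_def)
  next
    case True
    then obtain \<rho> where \<rho>: "\<rho> \<in> unifiers (L \<inter> L') G"
      "\<And>\<mu>. \<mu> \<in> unifiers L' G \<Longrightarrow> subst_eq (L \<inter> L') (subst \<mu> \<circ> \<rho>) \<mu>"
      using glue_projective[OF L L' proj G] by blast
    \<comment> \<open>Restriction to the copy \<open>3x\<close> returns to the original variables of
      \<open>A\<close>.\<close>
    define \<rho>' where "\<rho>' = (\<lambda>x. subst \<rho> (\<epsilon> (3 * x)))"
    have "subst \<rho>' A = subst \<rho> (subst \<epsilon> A3)"
      by (simp add: A3_def subst_comp comp_def \<rho>'_def)
    then have "\<rho>' \<in> unifiers (L \<inter> L') A"
      using \<rho>(1) And_theory[OF thI] by (simp add: unifiers_def G_def E_def)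
    moreover have "more_general (L \<inter> L') \<rho>' \<sigma>"
      if \<sigma>: "\<sigma> \<in> unifiers (L \<inter> L') A" "more_general L \<tau> \<sigma>" for \<sigma>
    proof -
      obtain \<mu> where \<mu>: "\<mu> \<in> unifiers L' G"
        "\<And>x. subst \<mu> (\<epsilon> (3 * x)) \<^bold>\<leftrightarrow> \<sigma> x \<in> L \<inter> L'"
        using lift[OF \<sigma>] by blast
      have "subst \<mu> (\<rho>' x) \<^bold>\<leftrightarrow> subst \<mu> (\<epsilon> (3 * x)) \<in> L \<inter> L'" for x
        using \<rho>(2)[OF \<mu>(1)] unfolding \<rho>'_def subst_comp subst_eq_def
        by (intro subst_cong[OF thI]) blast
      then have "subst_eq (L \<inter> L') (subst \<mu> \<circ> \<rho>') \<sigma>"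
        using \<mu>(2) Iff_trans[OF thI] unfolding subst_eq_def comp_def by blast
      then show ?thesis unfolding more_general_def by blast
    qed
    ultimately show ?thesis by blast
  qed
qed

theorem theorem5p11:
  fixes L L' :: "fm set"
  assumes "intermediate_logic L"
    and "locally_tabular L"
    and "finitary_unification L \<or> unitary_unification L"
    and "intermediate_logic L'"
    and "projective_unification L'"
  shows "finitary_unification (L \<inter> L') \<or> unitary_unification (L \<inter> L')"
proof -
  note L = assms(1) and L' = assms(4) and proj = assms(5)
  have "L \<noteq> {}" using imp_refl[OF logic_theory[OF L]] by blast
  then obtain C where C: "C \<in> L" "\<And>F. F \<in> L \<Longrightarrow> \<exists>\<nu>. subst \<nu> C \<^bold>\<rightarrow> F \<in> L'"
    using exists_strongest[OF logic_theory[OF L'] projective_lc[OF L' proj], of L] by blast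
  have "\<exists>U. finite U \<and> complete_unifiers (L \<inter> L') A U" if "unifiable (L \<inter> L') A" for A
  proof -
    have "unifiable L A" using that by (auto simp: unifiable_def unifiers_def)
    then have "\<exists>U. finite U \<and> complete_unifiers L A U"
      using assms(3)
    proof (elim disjE)
      assume "unitary_unification L"
      then obtain \<epsilon> where "\<epsilon> \<in> unifiers L A" "\<forall>\<mu>\<in>unifiers L A. more_general L \<epsilon> \<mu>"
        using \<open>unifiable L A\<close> unfolding unitary_unification_def by blast
      then show ?thesis by (intro exI[of _ "{\<epsilon>}"]) (simp add: complete_unifiers_def)
    qed (simp add: finitary_unification_def)
    then obtain U where U: "finite U" "complete_unifiers L A U" by blast
    then have "\<forall>\<tau>\<in>U. \<exists>\<rho>. \<forall>\<sigma>\<in>unifiers (L \<inter> L') A. more_general L \<tau> \<sigma> \<longrightarrow>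
        \<rho> \<in> unifiers (L \<inter> L') A \<and> more_general (L \<inter> L') \<rho> \<sigma>"
      using lift_unifier[OF L L' proj C] unfolding complete_unifiers_def by blast
    then obtain \<rho> where \<rho>: "\<And>\<tau> \<sigma>. \<tau> \<in> U \<Longrightarrow> \<sigma> \<in> unifiers (L \<inter> L') A \<Longrightarrow> more_general L \<tau> \<sigma> \<Longrightarrow>
        \<rho> \<tau> \<in> unifiers (L \<inter> L') A \<and> more_general (L \<inter> L') (\<rho> \<tau>) \<sigma>"
      by metis
    have "\<exists>\<tau>\<in>U. more_general L \<tau> \<sigma>" if "\<sigma> \<in> unifiers (L \<inter> L') A" for \<sigma>
      using U(2) that by (auto simp: complete_unifiers_def unifiers_def)
    \<comment> \<open>The intersection discards each \<open>\<rho> \<tau>\<close> that is not a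
      unifier; this can happen only if no unifier of \<open>A\<close> in
      \<open>L \<inter> L'\<close> is an \<open>L\<close>-instance of \<open>\<tau>\<close>.\<close>
    then have "complete_unifiers (L \<inter> L') A (\<rho> ` U \<inter> unifiers (L \<inter> L') A)"
      using \<rho> unfolding complete_unifiers_def by blast
    moreover have "finite (\<rho> ` U \<inter> unifiers (L \<inter> L') A)" using U(1) by simp
    ultimately show ?thesis by blast
  qed
  then show ?thesis unfolding finitary_unification_def by blast
qed

end
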